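(* For all positive integers $k$ and $n$, $$\sigma_k^{(-1)}(n)+J_k(n)+2=0\quad\Longleftrightarrow\quad n\text{ is prime}.$$ In particular, with $\sigma=\sigma_1$ and $J_1=\varphi$ (Euler's totient function), for all positive integers $n$, $$\sigma^{(-1)}(n)+\varphi(n)+2=0\quad\Longleftrightarrow\quad n\text{ is prime}.$$
   Context: For arithmetic functions $f,g:\{1,2,3,\ldots\}\to\mathbb{Z}$, the Dirichlet convolution is $(f*g)(n)=\sum_{d\mid n}f(d)g(n/d)$, with identity $\varepsilon$ given by $\varepsilon(1)=1$ and $\varepsilon(n)=0$ for $n>1$. If $f(1)\neq 0$, then $f^{(-1)}$ denotes the Dirichlet inverse of $f$ (not the pointwise reciprocal), i.e. the unique arithmetic function with $f*f^{(-1)}=\varepsilon$. For an integer $k\ge 1$, $\sigma_k(n)=\sum_{d\mid n}d^k$, and $\sigma_k^{(-1)}$ is its Dirichlet inverse. The $k$th Jordan totient function is $J_k(n)=\sum_{d\mid n}\mu(n/d)d^k=n^k\prod_{p\mid n}(1-p^{-k})$, where $\mu$ is the Möbius function and the product is over primes $p$ dividing $n$. *)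

theory Defs
  imports
    "HOL-Number_Theory.Totient"
    "HOL-Computational_Algebra.Squarefree"
begin

text \<open>
  Arithmetic functions are functions of type \<^typ>\<open>nat \<Rightarrow> int\<close> whose value at \<open>0\<close> is irrelevant.
  All the functions defined below take the value \<open>0\<close> there (the set of divisors of \<open>0\<close> is
  infinite, so a sum over it is \<open>0\<close>).
\<close>

definition dirichlet_prod :: "(nat \<Rightarrow> int) \<Rightarrow> (nat \<Rightarrow> int) \<Rightarrow> nat \<Rightarrow> int" where
  "dirichlet_prod f g n = (\<Sum>d | d dvd n. f d * g (n div d))"

definition dirichlet_one :: "nat \<Rightarrow> int" where
  "dirichlet_one n = (if n = 1 then 1 else 0)"

text \<open>
  The condition \<open>g 0 = 0\<close> only fixes the irrelevant value at \<open>0\<close>, so that the description has a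
  unique solution; see \<open>dirichlet_inverse_ex1\<close> below.
\<close>

definition dirichlet_inverse :: "(nat \<Rightarrow> int) \<Rightarrow> nat \<Rightarrow> int" where
  "dirichlet_inverse f =
     (THE g. g 0 = 0 \<and> (\<forall>n>0. dirichlet_prod f g n = dirichlet_one n))"

definition moebius_mu :: "nat \<Rightarrow> int" where
  "moebius_mu n = (if squarefree n then (-1) ^ card (prime_factors n) else 0)"

definition divisor_sigma :: "nat \<Rightarrow> nat \<Rightarrow> int" where
  "divisor_sigma k n = (\<Sum>d | d dvd n. int d ^ k)"

definition jordan_totient :: "nat \<Rightarrow> nat \<Rightarrow> int" where
  "jordan_totient k n = (\<Sum>d | d dvd n. moebius_mu (n div d) * int d ^ k)"

lemma dirichlet_prod_split:
  assumes "n > 0" "f 1 = 1"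
  shows "dirichlet_prod f g n = g n + (\<Sum>d | d dvd n \<and> d > 1. f d * g (n div d))"
proof -
  have "{d. d dvd n} = insert 1 {d. d dvd n \<and> d > 1}"
    using assms(1) by (auto dest: dvd_pos_nat)
  moreover have "finite {d. d dvd n \<and> d > 1}"
    using assms(1) by simp
  ultimately show ?thesis
    using assms(2) by (simp add: dirichlet_prod_def)
qed

lemma dirichlet_inverse_ex1:
  assumes f1: "f 1 = 1"
  shows "\<exists>!g. g 0 = 0 \<and> (\<forall>n>0. dirichlet_prod f g n = dirichlet_one n)"
proof -
  define F where "F = (\<lambda>(g :: nat \<Rightarrow> int) n. if n = 0 then 0 else
    dirichlet_one n - (\<Sum>d | d dvd n \<and> d > 1. f d * g (n div d)))"
  define g where "g = wfrec less_than F"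
  have g0: "g 0 = 0"
    unfolding g_def by (subst wfrec) (simp_all add: F_def)
  have g: "g n = dirichlet_one n - (\<Sum>d | d dvd n \<and> d > 1. f d * g (n div d))" if "n > 0" for n
  proof -
    have "g n = F (cut g less_than n) n"
      unfolding g_def by (rule wfrec) simp
    also have "\<dots> = dirichlet_one n - (\<Sum>d | d dvd n \<and> d > 1. f d * g (n div d))"
      using that by (simp add: F_def cut_apply)
    finally show ?thesis .
  qed
  show ?thesis
  proof (rule ex1I[of _ g])
    show "g 0 = 0 \<and> (\<forall>n>0. dirichlet_prod f g n = dirichlet_one n)"
    proof (intro conjI allI impI)
      show "dirichlet_prod f g n = dirichlet_one n" if "n > 0" for n
        using dirichlet_prod_split[of n f g] that f1 g[OF that] by simp
    qed (fact g0)
  next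
    fix h assume h: "h 0 = 0 \<and> (\<forall>n>0. dirichlet_prod f h n = dirichlet_one n)"
    have "h n = g n" for n
    proof (induction n rule: less_induct)
      case (less n)
      show ?case
      proof (cases "n = 0")
        case False
        have "(\<Sum>d | d dvd n \<and> d > 1. f d * h (n div d)) =
              (\<Sum>d | d dvd n \<and> d > 1. f d * g (n div d))"
          using False by (intro sum.cong refl) (simp add: less)
        moreover have "dirichlet_prod f h n = dirichlet_one n"
          using h False by simp
        ultimately show ?thesis
          using False g[of n] dirichlet_prod_split[of n f h] f1 by simp
      qed (use h g0 in simp)
    qed
    then show "h = g" by blast
  qed
qed

lemma divisor_sigma_1: "divisor_sigma k 1 = 1"
  by (simp add: divisor_sigma_def)

end

theory Submission
  imports Defs
begin

text \<open>
  Both sides of the equation are built from multiplicative functions, so everything can be read off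
  from the values at prime powers.  Write \<open>q = p ^ k\<close>.  On the powers of \<open>p\<close>, the function
  \<open>\<sigma>\<^sub>k\<close> has the generating series \<open>1 / ((1 - X) (1 - q X))\<close>, so its Dirichlet inverse has the series
  \<open>1 - (1 + q) X + q X\<^sup>2\<close>: it is \<open>- (1 + q)\<close> at \<open>p\<close>, \<open>q\<close> at \<open>p\<^sup>2\<close> and \<open>0\<close> at all higher powers
  (\<open>dirichlet_inverse_divisor_sigma\<close>).  Likewise \<open>J\<^sub>k (p ^ a) = (q - 1) q ^ (a - 1)\<close>
  (\<open>jordan_totient_prod\<close>).  For a prime \<open>n\<close> the sum is \<open>- (1 + q) + (q - 1) + 2 = 0\<close>.

  Conversely, let the sum vanish at \<open>n\<close>, and note that \<open>J\<^sub>k n > 0\<close>.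

  \<^item> If \<open>p ^ 3\<close> divides \<open>n\<close> for some prime \<open>p\<close>, then the inverse is \<open>0\<close> at \<open>n\<close> and the sum is positive.

  \<^item> If some exponent is exactly \<open>2\<close>, then \<open>q\<close> divides both the inverse and \<open>J\<^sub>k n\<close>, hence also \<open>2\<close>;
    so \<open>p = 2\<close> and \<open>k = 1\<close>.  Any further prime factor \<open>r\<close> is odd and contributes the even factors
    \<open>- (1 + r)\<close> and \<open>r - 1\<close> (or a multiple of \<open>r\<close>, which is ruled out by the same argument), so that
    \<open>4\<close> would divide \<open>2\<close>.  With no further prime factor, \<open>n = 4\<close> and the sum is positive.

  \<^item> If \<open>n\<close> is squarefree, taking absolute values turns the equation into
    \<open>\<Prod>(1 + q) = \<Prod>(q - 1) + 2\<close>.  With no prime factor the original sum is \<open>4\<close>, with exactly one the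
    number \<open>n\<close> is prime, and with two or more the left side is too large
    (\<open>prod_succ_gt_prod_pred\<close>).
\<close>

section \<open>Multiplicative functions\<close>

definition multiplicative :: "(nat \<Rightarrow> int) \<Rightarrow> bool" where
  "multiplicative f \<longleftrightarrow>
     f 1 = 1 \<and> (\<forall>m n. m > 0 \<longrightarrow> n > 0 \<longrightarrow> coprime m n \<longrightarrow> f (m * n) = f m * f n)"

lemma multiplicativeI:
  assumes "f 1 = 1"
    and "\<And>m n. m > 0 \<Longrightarrow> n > 0 \<Longrightarrow> coprime m n \<Longrightarrow> f (m * n) = f m * f n"
  shows "multiplicative f"
  using assms by (simp add: multiplicative_def)

lemma multiplicative_1: "multiplicative f \<Longrightarrow> f (Suc 0) = 1"
  by (simp add: multiplicative_def)

lemma multiplicative_mult: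
  "multiplicative f \<Longrightarrow> m > 0 \<Longrightarrow> n > 0 \<Longrightarrow> coprime m n \<Longrightarrow> f (m * n) = f m * f n"
  by (simp add: multiplicative_def)

lemma multiplicative_prod_coprime:
  assumes f: "multiplicative f" and "finite A"
    and "\<And>x. x \<in> A \<Longrightarrow> g x > 0"
    and "\<And>x y. x \<in> A \<Longrightarrow> y \<in> A \<Longrightarrow> x \<noteq> y \<Longrightarrow> coprime (g x) (g y)"
  shows "f (\<Prod>x\<in>A. g x) = (\<Prod>x\<in>A. f (g x))"
  using assms(2-)
proof (induction A rule: finite_induct)
  case empty
  then show ?case using multiplicative_1[OF f] by simp
next
  case (insert x A)
  have "coprime (g x) (prod g A)"
    using insert by (intro prod_coprime_right) auto
  moreover have "prod g A > 0"
    using insert by (intro prod_pos) auto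
  ultimately show ?case
    using insert multiplicative_mult[OF f, of "g x" "prod g A"] by auto
qed

lemma multiplicative_eq_prod_prime_powers:
  assumes f: "multiplicative f" and n: "n > 0"
  shows "f n = (\<Prod>p\<in>prime_factors n. f (p ^ multiplicity p n))"
proof -
  have "f n = f (\<Prod>p\<in>prime_factors n. p ^ multiplicity p n)"
    by (subst prod_prime_factors) (use n in simp_all)
  also have "\<dots> = (\<Prod>p\<in>prime_factors n. f (p ^ multiplicity p n))"
  proof (rule multiplicative_prod_coprime[OF f])
    fix p q assume "p \<in> prime_factors n" "q \<in> prime_factors n" "p \<noteq> q"
    then have "coprime p q" by (intro primes_coprime in_prime_factors_imp_prime)
    then show "coprime (p ^ multiplicity p n) (q ^ multiplicity q n)" by simp
  next
    fix p assume "p \<in> prime_factors n"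
    then show "p ^ multiplicity p n > 0"
      by (simp add: in_prime_factors_imp_prime prime_gt_0_nat)
  qed simp
  finally show ?thesis .
qed

lemma multiplicative_eqI:
  assumes f: "multiplicative f" and g: "multiplicative g"
    and eq: "\<And>p a. prime p \<Longrightarrow> f (p ^ a) = g (p ^ a)" and n: "n > 0"
  shows "f n = g n"
  unfolding multiplicative_eq_prod_prime_powers[OF f n] multiplicative_eq_prod_prime_powers[OF g n]
  by (intro prod.cong refl eq in_prime_factors_imp_prime)

lemma prime_factors_coprime_disjoint:
  "coprime (m :: nat) n \<Longrightarrow> prime_factors m \<inter> prime_factors n = {}"
  using coprime_common_divisor[of m n] not_prime_unit by (auto simp: in_prime_factors_iff)

text \<open>
  Together with the next lemma, this yields a multiplicative function from values \<open>c p a\<close>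
  prescribed at the prime powers \<open>p ^ a\<close> with \<open>a > 0\<close>.
\<close>

lemma multiplicative_local_prod:
  assumes F: "\<And>n. n > 0 \<Longrightarrow> F n = (\<Prod>p\<in>prime_factors n. c p (multiplicity p n))"
  shows "multiplicative F"
proof (rule multiplicativeI)
  show "F 1 = 1" by (subst F) auto
next
  fix m n :: nat
  assume mn: "m > 0" "n > 0" "coprime m n"
  have *: "multiplicity p (x * y) = multiplicity p x"
    if "p \<in> prime_factors x" "coprime x y" "x > 0" "y > 0" for p x y :: nat
  proof -
    have "\<not> p dvd y"
      using that coprime_common_divisor[of x y p] not_prime_unit by (auto simp: in_prime_factors_iff)
    then show ?thesis
      using that by (simp add: prime_elem_multiplicity_mult_distrib in_prime_factors_iff
          not_dvd_imp_multiplicity_0)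
  qed
  have "F (m * n) = (\<Prod>p\<in>prime_factors m \<union> prime_factors n. c p (multiplicity p (m * n)))"
    using mn by (simp add: F prime_factors_product)
  also have "\<dots> = (\<Prod>p\<in>prime_factors m. c p (multiplicity p (m * n))) *
                  (\<Prod>p\<in>prime_factors n. c p (multiplicity p (m * n)))"
    using mn prime_factors_coprime_disjoint by (intro prod.union_disjoint) auto
  also have "(\<Prod>p\<in>prime_factors m. c p (multiplicity p (m * n))) = F m"
    unfolding F[OF mn(1)] by (rule prod.cong) (auto simp: * mn)
  also have "(\<Prod>p\<in>prime_factors n. c p (multiplicity p (m * n))) = F n"
    unfolding F[OF mn(2)]
    by (rule prod.cong) (use mn *[of _ n m] in \<open>auto simp: coprime_commute mult.commute\<close>)
  finally show "F (m * n) = F m * F n" .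
qed

lemma local_prod_prime_power:
  fixes p :: nat
  assumes "prime p" "a > 0"
  shows "(\<Prod>r\<in>prime_factors (p ^ a). c r (multiplicity r (p ^ a))) = c p a"
  using assms by (simp add: prime_factorization_prime_power)

section \<open>Dirichlet products of multiplicative functions\<close>

text \<open>The inverse map is \<open>x \<mapsto> (gcd x m, gcd x n)\<close>.\<close>

lemma bij_betw_divisors_coprime_mult:
  fixes m n :: nat
  assumes "coprime m n"
  shows "bij_betw (\<lambda>(d, e). d * e) ({d. d dvd m} \<times> {e. e dvd n}) {d. d dvd m * n}"
  unfolding bij_betw_def
proof
  have gcd1: "gcd (d * e) m = d" and gcd2: "gcd (d * e) n = e" if "d dvd m" "e dvd n" for d e
  proof -
    have "coprime m e" "coprime n d"
      using coprime_divisors[OF dvd_refl that(2) assms] coprime_divisors[OF that(1) dvd_refl assms]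
      by (simp_all add: coprime_commute)
    then have "gcd (d * e) m = gcd d m" "gcd (d * e) n = gcd e n"
      by (simp_all only: gcd_mult_left_right_cancel gcd_mult_left_left_cancel)
    then show "gcd (d * e) m = d" "gcd (d * e) n = e"
      using that by (simp_all only: gcd_nat.absorb1)
  qed
  show "inj_on (\<lambda>(d, e). d * e) ({d. d dvd m} \<times> {e. e dvd n})"
  proof (rule inj_onI, clarsimp)
    fix d e d' e' assume "d dvd m" "e dvd n" "d' dvd m" "e' dvd n" "d * e = d' * e'"
    then show "d = d' \<and> e = e'"
      using gcd1[of d e] gcd1[of d' e'] gcd2[of d e] gcd2[of d' e'] by simp
  qed
  show "(\<lambda>(d, e). d * e) ` ({d. d dvd m} \<times> {e. e dvd n}) = {d. d dvd m * n}"
  proof safe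
    fix x assume "x dvd m * n"
    then obtain b c where "x = b * c" "b dvd m" "c dvd n"
      using division_decomp by blast
    then show "x \<in> (\<lambda>(d, e). d * e) ` ({d. d dvd m} \<times> {e. e dvd n})"
      by force
  qed (simp add: mult_dvd_mono)
qed

text \<open>
  Splitting each divisor of \<open>m * n\<close> into its parts in \<open>m\<close> and in \<open>n\<close> turns the sum at \<open>m * n\<close> into
  a double sum whose summands factor.
\<close>

lemma multiplicative_dirichlet_prod:
  assumes f: "multiplicative f" and g: "multiplicative g"
  shows "multiplicative (dirichlet_prod f g)"
proof (rule multiplicativeI)
  show "dirichlet_prod f g 1 = 1"
    using multiplicative_1[OF f] multiplicative_1[OF g] by (simp add: dirichlet_prod_def)
next
  fix m n :: nat
  assume mn: "m > 0" "n > 0" "coprime m n"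
  have "dirichlet_prod f g (m * n) =
          (\<Sum>(d, e)\<in>{d. d dvd m} \<times> {e. e dvd n}. f (d * e) * g (m * n div (d * e)))"
    unfolding dirichlet_prod_def
    by (subst sum.reindex_bij_betw[OF bij_betw_divisors_coprime_mult[OF mn(3)], symmetric])
       (simp add: case_prod_unfold)
  also have "\<dots> = (\<Sum>(d, e)\<in>{d. d dvd m} \<times> {e. e dvd n}.
                     (f d * g (m div d)) * (f e * g (n div e)))"
  proof (intro sum.cong refl, clarify)
    fix d e assume de: "d dvd m" "e dvd n"
    have pos: "d > 0" "e > 0" "m div d > 0" "n div e > 0"
      using de mn by (simp_all add: dvd_pos_nat[of m d] dvd_pos_nat[of n e] dvd_imp_le div_greater_zero_iff)
    have "m div d dvd m" "n div e dvd n"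
      using de dvdI[of m "m div d" d] dvdI[of n "n div e" e] by simp_all
    then have "coprime d e" "coprime (m div d) (n div e)"
      using de mn(3) coprime_divisors by blast+
    moreover have "m * n div (d * e) = (m div d) * (n div e)"
      using de by (simp add: div_mult_div_if_dvd)
    ultimately show "f (d * e) * g (m * n div (d * e)) =
                      (f d * g (m div d)) * (f e * g (n div e))"
      using pos by (simp add: multiplicative_mult[OF f] multiplicative_mult[OF g])
  qed
  also have "\<dots> = dirichlet_prod f g m * dirichlet_prod f g n"
    unfolding dirichlet_prod_def by (simp add: sum_product sum.cartesian_product)
  finally show "dirichlet_prod f g (m * n) = dirichlet_prod f g m * dirichlet_prod f g n" .
qed

lemma sum_divisors_prime_power:
  fixes p :: nat and h :: "nat \<Rightarrow> int"
  assumes "prime p"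
  shows "(\<Sum>d | d dvd p ^ a. h d) = (\<Sum>i\<le>a. h (p ^ i))"
proof -
  have "{d. d dvd p ^ a} = (\<lambda>i. p ^ i) ` {..a}"
    using divides_primepow_nat[OF assms] by auto
  moreover have "inj_on (\<lambda>i. p ^ i) {..a}"
    using prime_gt_1_nat[OF assms] by (auto intro!: inj_onI)
  ultimately show ?thesis by (simp add: sum.reindex)
qed

lemma dirichlet_prod_prime_power:
  assumes p: "prime p"
  shows "dirichlet_prod f g (p ^ a) = (\<Sum>i\<le>a. f (p ^ (a - i)) * g (p ^ i))"
proof -
  have "dirichlet_prod f g (p ^ a) = (\<Sum>i\<le>a. f (p ^ i) * g (p ^ a div p ^ i))"
    unfolding dirichlet_prod_def by (rule sum_divisors_prime_power[OF p])
  also have "\<dots> = (\<Sum>i\<le>a. f (p ^ i) * g (p ^ (a - i)))"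
    using prime_gt_0_nat[OF p] by (intro sum.cong refl) (simp add: power_diff)
  also have "\<dots> = (\<Sum>i\<le>a. f (p ^ (a - i)) * g (p ^ i))"
    by (rule sum.reindex_bij_witness[of _ "\<lambda>i. a - i" "\<lambda>i. a - i"]) auto
  finally show ?thesis .
qed

lemma multiplicative_power: "multiplicative (\<lambda>n. int n ^ k)"
  by (rule multiplicativeI) (simp_all add: power_mult_distrib)

lemma multiplicative_dirichlet_one: "multiplicative dirichlet_one"
  by (rule multiplicativeI) (auto simp: dirichlet_one_def)

lemma multiplicative_moebius_mu: "multiplicative moebius_mu"
proof (rule multiplicativeI)
  show "moebius_mu 1 = 1" by (simp add: moebius_mu_def)
next
  fix m n :: nat
  assume mn: "m > 0" "n > 0" "coprime m n"
  have "card (prime_factors (m * n)) = card (prime_factors m) + card (prime_factors n)"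
    using mn prime_factors_coprime_disjoint[of m n]
    by (simp add: prime_factors_product card_Un_disjoint)
  moreover have "squarefree (m * n) \<longleftrightarrow> squarefree m \<and> squarefree n"
    using mn squarefree_multD squarefree_mult_coprime by blast
  ultimately show "moebius_mu (m * n) = moebius_mu m * moebius_mu n"
    by (simp add: moebius_mu_def power_add)
qed

lemma moebius_mu_prime_power:
  assumes "prime p"
  shows "moebius_mu (p ^ a) = (if a = 0 then 1 else if a = 1 then -1 else 0)"
proof -
  have "squarefree (p ^ a) \<longleftrightarrow> a = 0 \<or> a = 1"
    using assms squarefree_prime[OF assms] by (auto simp: squarefree_power_iff)
  moreover have "prime_factors (p ^ 1) = {p}"
    using assms by (simp add: prime_factorization_prime)
  ultimately show ?thesis
    by (auto simp: moebius_mu_def)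
qed

section \<open>Values of the two functions\<close>

lemma jordan_totient_conv: "jordan_totient k = dirichlet_prod (\<lambda>d. int d ^ k) moebius_mu"
  by (simp add: fun_eq_iff jordan_totient_def dirichlet_prod_def mult.commute)

lemma multiplicative_jordan_totient: "multiplicative (jordan_totient k)"
  unfolding jordan_totient_conv
  by (intro multiplicative_dirichlet_prod multiplicative_power multiplicative_moebius_mu)

lemma jordan_totient_prime_power:
  assumes p: "prime p" and a: "a > 0"
  shows "jordan_totient k (p ^ a) = (int p ^ k - 1) * (int p ^ k) ^ (a - 1)"
proof -
  obtain b where b: "a = Suc b" using a gr0_implies_Suc by blast
  have "jordan_totient k (p ^ a) =
          (\<Sum>i\<le>a. int (p ^ (a - i)) ^ k * (if i = 0 then 1 else if i = 1 then -1 else 0))"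
    by (simp only: jordan_totient_conv dirichlet_prod_prime_power[OF p] moebius_mu_prime_power[OF p])
  also have "\<dots> = (\<Sum>i\<in>{0, 1}. int (p ^ (a - i)) ^ k *
                     (if i = 0 then 1 else if i = 1 then -1 else 0))"
    using a by (intro sum.mono_neutral_right) auto
  also have "\<dots> = (int p ^ Suc b) ^ k - (int p ^ b) ^ k"
    unfolding b by (simp del: power_Suc)
  also have "\<dots> = (int p ^ k - 1) * (int p ^ k) ^ b"
    by (simp add: power_mult_distrib algebra_simps flip: power_mult)
  finally show ?thesis using b by simp
qed

lemma jordan_totient_prod:
  assumes "n > 0"
  shows "jordan_totient k n =
    (\<Prod>p\<in>prime_factors n. (int p ^ k - 1) * (int p ^ k) ^ (multiplicity p n - 1))"
  unfolding multiplicative_eq_prod_prime_powers[OF multiplicative_jordan_totient assms]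
  by (intro prod.cong refl jordan_totient_prime_power)
     (auto simp: prime_factors_multiplicity)

lemma jordan_totient_1_eq_totient:
  assumes "n > 0"
  shows "jordan_totient 1 n = int (totient n)"
proof (rule multiplicative_eqI[OF multiplicative_jordan_totient _ _ assms])
  show "multiplicative (\<lambda>n. int (totient n))"
    by (rule multiplicativeI) (simp_all add: totient_mult_coprime)
  show "jordan_totient 1 (p ^ a) = int (totient (p ^ a))" if "prime p" for p a
  proof (cases "a = 0")
    case True
    then show ?thesis using multiplicative_1[OF multiplicative_jordan_totient] by simp
  next
    case False
    then show ?thesis
      using that prime_gt_0_nat[OF that]
      by (simp add: jordan_totient_prime_power totient_prime_power of_nat_diff)
  qed
qed

lemma divisor_sigma_conv: "divisor_sigma k = dirichlet_prod (\<lambda>d. int d ^ k) (\<lambda>_. 1)"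
  by (simp add: fun_eq_iff divisor_sigma_def dirichlet_prod_def)

lemma multiplicative_divisor_sigma: "multiplicative (divisor_sigma k)"
  unfolding divisor_sigma_conv
  by (intro multiplicative_dirichlet_prod multiplicative_power) (simp add: multiplicative_def)

lemma divisor_sigma_prime_power:
  "prime p \<Longrightarrow> divisor_sigma k (p ^ a) = (\<Sum>i\<le>a. (int p ^ k) ^ i)"
  by (simp add: divisor_sigma_def sum_divisors_prime_power mult.commute flip: power_mult)

text \<open>The coefficient of \<open>X ^ a\<close> in \<open>(1 - X) (1 - q X)\<close>.\<close>

definition sigma_inverse_coeff :: "int \<Rightarrow> nat \<Rightarrow> int" where
  "sigma_inverse_coeff q a =
     (if a = 0 then 1 else if a = 1 then - (1 + q) else if a = 2 then q else 0)"

definition sigma_inverse :: "nat \<Rightarrow> nat \<Rightarrow> int" where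
  "sigma_inverse k n = (if n = 0 then 0 else
     (\<Prod>p\<in>prime_factors n. sigma_inverse_coeff (int p ^ k) (multiplicity p n)))"

lemma multiplicative_sigma_inverse: "multiplicative (sigma_inverse k)"
  by (rule multiplicative_local_prod[where c = "\<lambda>p. sigma_inverse_coeff (int p ^ k)"])
     (simp add: sigma_inverse_def)

lemma sigma_inverse_prime_power:
  assumes "prime p"
  shows "sigma_inverse k (p ^ a) = sigma_inverse_coeff (int p ^ k) a"
proof (cases "a = 0")
  case True
  then show ?thesis by (simp add: sigma_inverse_def sigma_inverse_coeff_def)
next
  case False
  then show ?thesis
    using assms local_prod_prime_power[of p a "\<lambda>p. sigma_inverse_coeff (int p ^ k)"]
    by (auto simp: sigma_inverse_def)
qed

text \<open>
  This is the identity \<open>(\<Sum>i. (1 + q + \<dots> + q ^ i) X ^ i) (1 - X) (1 - q X) = 1\<close> of power series,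
  coefficient by coefficient.
\<close>

lemma geometric_conv_sigma_inverse_coeff:
  "(\<Sum>i\<le>a. (\<Sum>j\<le>a - i. q ^ j) * sigma_inverse_coeff q i) = (if a = 0 then 1 else 0)"
proof -
  consider "a = 0" | "a = 1" | b where "a = Suc (Suc b)"
    by (metis One_nat_def not0_implies_Suc)
  then show ?thesis
  proof cases
    case 3
    have "(\<Sum>i\<le>a. (\<Sum>j\<le>a - i. q ^ j) * sigma_inverse_coeff q i) =
            (\<Sum>i\<in>{0, 1, 2}. (\<Sum>j\<le>a - i. q ^ j) * sigma_inverse_coeff q i)"
      unfolding 3 by (intro sum.mono_neutral_right) (auto simp: sigma_inverse_coeff_def)
    also have "\<dots> =
            (\<Sum>j\<le>Suc (Suc b). q ^ j) - (1 + q) * (\<Sum>j\<le>Suc b. q ^ j) + q * (\<Sum>j\<le>b. q ^ j)"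
      unfolding 3
      by (simp add: sigma_inverse_coeff_def numeral_2_eq_2 mult.commute[of _ q]
          mult.commute[of _ "- 1 - q"] left_diff_distrib distrib_right
          del: sum.atMost_Suc)
    also have "\<dots> = 0" by (simp add: algebra_simps)
    finally show ?thesis using 3 by simp
  qed (simp_all add: sigma_inverse_coeff_def)
qed

lemma dirichlet_inverse_divisor_sigma: "dirichlet_inverse (divisor_sigma k) = sigma_inverse k"
  unfolding dirichlet_inverse_def
proof (rule the1_equality[OF dirichlet_inverse_ex1[of "divisor_sigma k", OF divisor_sigma_1]], intro conjI allI impI)
  show "sigma_inverse k 0 = 0" by (simp add: sigma_inverse_def)
next
  fix n :: nat assume n: "n > 0"
  show "dirichlet_prod (divisor_sigma k) (sigma_inverse k) n = dirichlet_one n"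
  proof (rule multiplicative_eqI[OF _ multiplicative_dirichlet_one _ n])
    show "multiplicative (dirichlet_prod (divisor_sigma k) (sigma_inverse k))"
      by (intro multiplicative_dirichlet_prod multiplicative_divisor_sigma
          multiplicative_sigma_inverse)
  next
    fix p a :: nat assume p: "prime p"
    show "dirichlet_prod (divisor_sigma k) (sigma_inverse k) (p ^ a) = dirichlet_one (p ^ a)"
      using p not_prime_1
      by (auto simp: dirichlet_prod_prime_power[OF p] divisor_sigma_prime_power[OF p]
          sigma_inverse_prime_power[OF p] geometric_conv_sigma_inverse_coeff dirichlet_one_def)
  qed
qed

section \<open>Solving the equation\<close>

text \<open>
  Split off one factor \<open>q x\<close> and let \<open>P \<ge> Q\<close> be the two products over the remaining indices. Then
  \<open>(1 + q x) P - (q x - 1) Q = q x (P - Q) + P + Q\<close>, and since another index remains, \<open>P \<ge> 3\<close> and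
  \<open>Q \<ge> 1\<close>.
\<close>

lemma prod_succ_gt_prod_pred:
  fixes q :: "'a \<Rightarrow> int"
  assumes "finite A" "card A \<ge> 2" "\<And>x. x \<in> A \<Longrightarrow> q x \<ge> 2"
  shows "(\<Prod>x\<in>A. 1 + q x) > (\<Prod>x\<in>A. q x - 1) + 2"
proof -
  obtain x where x: "x \<in> A" using assms(2) by fastforce
  define B where "B = A - {x}"
  define P where "P = (\<Prod>x\<in>B. 1 + q x)"
  define Q where "Q = (\<Prod>x\<in>B. q x - 1)"
  have q: "q y \<ge> 2" if "y \<in> B" for y using assms(3) that by (simp add: B_def)
  have fB: "finite B" using assms(1) by (simp add: B_def)
  have "card B \<ge> 1" using assms(1,2) x by (simp add: B_def)
  then have "B \<noteq> {}" by auto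
  then obtain y where y: "y \<in> B" by blast
  have "Q \<ge> 1" unfolding Q_def by (rule prod_ge_1) (use q in force)
  have "P \<ge> Q" unfolding P_def Q_def by (rule prod_mono) (use q in force)
  have "P = (1 + q y) * (\<Prod>x\<in>B - {y}. 1 + q x)"
    unfolding P_def by (rule prod.remove[OF fB y])
  moreover have "(\<Prod>x\<in>B - {y}. 1 + q x) \<ge> 1" by (rule prod_ge_1) (use q in force)
  ultimately have "P \<ge> 3 * 1" using q[OF y]
    by (simp only:) (intro mult_mono, auto)
  have "q x * Q \<le> q x * P" using \<open>P \<ge> Q\<close> assms(3)[OF x] by (intro mult_left_mono) auto
  then have "(1 + q x) * P > (q x - 1) * Q + 2"
    using \<open>Q \<ge> 1\<close> \<open>P \<ge> 3 * 1\<close> by (simp add: algebra_simps)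
  then show ?thesis
    unfolding P_def Q_def B_def
    by (simp only: prod.remove[OF assms(1) x, of "\<lambda>x. 1 + q x"]
        prod.remove[OF assms(1) x, of "\<lambda>x. q x - 1"])
qed

lemma prime_factor_power_ge_2:
  assumes "p \<in> prime_factors (n :: nat)" "k > 0"
  shows "int p ^ k \<ge> 2"
proof -
  have "p \<ge> 2" using assms(1) by (intro prime_ge_2_nat in_prime_factors_imp_prime)
  then have "2 \<le> int p ^ 1" by simp
  also have "int p ^ 1 \<le> int p ^ k"
    using assms(2) \<open>p \<ge> 2\<close> by (intro power_increasing) auto
  finally show ?thesis .
qed

lemma sigma_inverse_dvd:
  assumes "p \<in> prime_factors n" "n > 0"
  shows "sigma_inverse_coeff (int p ^ k) (multiplicity p n) dvd sigma_inverse k n"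
  using assms by (auto simp: sigma_inverse_def intro!: dvd_prodI)

lemma jordan_totient_dvd:
  assumes "p \<in> prime_factors n" "n > 0"
  shows "(int p ^ k - 1) * (int p ^ k) ^ (multiplicity p n - 1) dvd jordan_totient k n"
  using assms unfolding jordan_totient_prod[OF assms(2)] by (auto intro!: dvd_prodI)

lemma jordan_totient_pos:
  assumes "n > 0" "k > 0"
  shows "jordan_totient k n > 0"
  unfolding jordan_totient_prod[OF assms(1)]
proof (rule prod_pos)
  fix p assume "p \<in> prime_factors n"
  then have "int p ^ k \<ge> 2" using assms(2) by (rule prime_factor_power_ge_2)
  then show "(int p ^ k - 1) * (int p ^ k) ^ (multiplicity p n - 1) > 0"
    by (intro mult_pos_pos zero_less_power[of "int p ^ k"]) linarith+
qed

text \<open>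
  The case of an exponent of at least \<open>2\<close>: divisibility by \<open>p ^ k\<close> leaves only \<open>p ^ k = 2\<close>, and then
  divisibility by \<open>4\<close> excludes further prime factors.
\<close>

lemma squarefree_if_sigma_inverse_jordan_zero:
  assumes n: "n > 0" and k: "k > 0" and eq: "sigma_inverse k n + jordan_totient k n + 2 = 0"
  shows "squarefree n"
proof (rule ccontr)
  assume "\<not> squarefree n"
  then obtain p where p: "p \<in> prime_factors n" "multiplicity p n \<noteq> 1"
    using squarefree_factorial_semiring'[of n] n by auto
  have Jpos: "jordan_totient k n > 0" by (rule jordan_totient_pos[OF n k])
  \<comment> \<open>Exponents above \<open>2\<close> make the inverse vanish; exponent \<open>2\<close> forces \<open>r ^ k\<close> to divide \<open>2\<close>.\<close>
  have two: "multiplicity r n = 2 \<and> r = 2 \<and> k = 1"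
    if r: "r \<in> prime_factors n" "multiplicity r n \<noteq> 1" for r
  proof -
    have "multiplicity r n > 0" using r by (simp add: prime_factors_multiplicity)
    have "multiplicity r n = 2"
    proof (rule ccontr)
      assume "multiplicity r n \<noteq> 2"
      then have "sigma_inverse_coeff (int r ^ k) (multiplicity r n) = 0"
        using r \<open>multiplicity r n > 0\<close> by (simp add: sigma_inverse_coeff_def)
      then have "sigma_inverse k n = 0" using sigma_inverse_dvd[OF r(1) n, of k] by simp
      then show False using eq Jpos by simp
    qed
    then have "int r ^ k dvd sigma_inverse k n" "int r ^ k dvd jordan_totient k n"
      using sigma_inverse_dvd[OF r(1) n, of k] jordan_totient_dvd[OF r(1) n, of k]
      by (auto simp: sigma_inverse_coeff_def elim: dvd_mult_right)
    then have "int r ^ k dvd - (sigma_inverse k n + jordan_totient k n)"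
      by simp
    also have "\<dots> = 2" using eq by simp
    finally have "int (r ^ k) dvd int 2" by simp
    then have d: "r ^ k dvd 2" by (simp only: int_dvd_int_iff)
    have "r \<ge> 2" using r by (auto simp: in_prime_factors_iff prime_ge_2_nat)
    have "r ^ 1 \<le> r ^ k" using k \<open>r \<ge> 2\<close> by (intro power_increasing) auto
    with d \<open>r \<ge> 2\<close> have "r = 2" using dvd_imp_le[OF d] by simp
    moreover have "k = 1"
    proof (rule ccontr)
      assume "k \<noteq> 1"
      then have "(2::nat) ^ 2 \<le> 2 ^ k" using k by (intro power_increasing) auto
      then show False using dvd_imp_le[OF d] \<open>r = 2\<close> by simp
    qed
    ultimately show ?thesis using \<open>multiplicity r n = 2\<close> by simp
  qed
  have p2: "multiplicity 2 n = 2" "k = 1" "2 \<in> prime_factors n"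
    using two[OF p] p by auto
  show False
  proof (cases "prime_factors n = {2}")
    case True
    then have "sigma_inverse k n > 0"
      using n p2 by (simp add: sigma_inverse_def sigma_inverse_coeff_def)
    then show False using Jpos eq by simp
  next
    case False
    then obtain r where r: "r \<in> prime_factors n" "r \<noteq> 2" using p2 by blast
    then have rm: "multiplicity r n = 1" using two by blast
    have "prime r" using r by (simp add: in_prime_factors_iff)
    then have "odd r" using r(2) primes_dvd_imp_eq two_is_prime_nat by blast
    \<comment> \<open>The factors at \<open>2\<close> and at the odd prime \<open>r\<close> are both even, in either product.\<close>
    have sub: "{2, r} \<subseteq> prime_factors n" using r p2 by auto
    have "(\<Prod>p\<in>{2, r}. sigma_inverse_coeff (int p ^ k) (multiplicity p n)) dvd sigma_inverse k n"
      using n sub by (simp add: sigma_inverse_def prod_dvd_prod_subset)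
    moreover have "(\<Prod>p\<in>{2, r}. sigma_inverse_coeff (int p ^ k) (multiplicity p n)) =
                     - (2 * (1 + int r))"
      using r rm p2 by (simp add: sigma_inverse_coeff_def)
    ultimately have "2 * (1 + int r) dvd sigma_inverse k n"
      by (simp only: minus_dvd_iff)
    moreover have "(2 :: int) * 2 dvd 2 * (1 + int r)"
      using \<open>odd r\<close> by (intro mult_dvd_mono) auto
    ultimately have 1: "4 dvd sigma_inverse k n" using dvd_trans by fastforce
    have "(\<Prod>p\<in>{2, r}. (int p ^ k - 1) * (int p ^ k) ^ (multiplicity p n - 1))
            dvd jordan_totient k n"
      unfolding jordan_totient_prod[OF n] using sub by (intro prod_dvd_prod_subset) auto
    then have "2 * (int r - 1) dvd jordan_totient k n"
      using r rm p2 by simp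
    moreover have "(2 :: int) * 2 dvd 2 * (int r - 1)"
      using \<open>odd r\<close> by (intro mult_dvd_mono) auto
    ultimately have 2: "4 dvd jordan_totient k n" using dvd_trans by fastforce
    have "(4 :: int) dvd - (sigma_inverse k n + jordan_totient k n)"
      using 1 2 by simp
    also have "\<dots> = 2" using eq by simp
    finally show False by simp
  qed
qed

lemma sigma_inverse_jordan_zero_iff_prime:
  assumes n: "n > 0" and k: "k > 0"
  shows "sigma_inverse k n + jordan_totient k n + 2 = 0 \<longleftrightarrow> prime n"
proof
  assume "prime n"
  then show "sigma_inverse k n + jordan_totient k n + 2 = 0"
    using sigma_inverse_prime_power[of n k 1] jordan_totient_prime_power[of n 1 k]
    by (simp add: sigma_inverse_coeff_def)
next
  assume eq: "sigma_inverse k n + jordan_totient k n + 2 = 0"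
  have "squarefree n" by (rule squarefree_if_sigma_inverse_jordan_zero[OF n k eq])
  then have mult: "multiplicity p n = 1" if "p \<in> prime_factors n" for p
    using that squarefree_factorial_semiring'[of n] n by auto
  have s: "sigma_inverse k n = (\<Prod>p\<in>prime_factors n. - (1 + int p ^ k))"
    unfolding sigma_inverse_def using n
    by (auto intro!: prod.cong simp: mult sigma_inverse_coeff_def)
  have J: "jordan_totient k n = (\<Prod>p\<in>prime_factors n. int p ^ k - 1)"
    unfolding jordan_totient_prod[OF n] by (intro prod.cong refl) (simp add: mult)
  \<comment> \<open>Absolute values remove the sign, which depends on the parity of the number of prime factors.\<close>
  have "\<bar>sigma_inverse k n\<bar> = (\<Prod>p\<in>prime_factors n. 1 + int p ^ k)"
    unfolding s abs_prod abs_minus_cancel by (intro prod.cong refl abs_of_nonneg) simp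
  moreover have "\<bar>sigma_inverse k n\<bar> = jordan_totient k n + 2"
    using eq jordan_totient_pos[OF n k] by simp
  ultimately have "(\<Prod>p\<in>prime_factors n. 1 + int p ^ k) = (\<Prod>p\<in>prime_factors n. int p ^ k - 1) + 2"
    using J by simp
  then have "\<not> card (prime_factors n) \<ge> 2"
    using prod_succ_gt_prod_pred[of "prime_factors n" "\<lambda>p. int p ^ k"]
      prime_factor_power_ge_2[OF _ k] by force
  moreover have "prime_factors n \<noteq> {}"
    using eq s J by auto
  then have "card (prime_factors n) \<noteq> 0" by simp
  ultimately have "card (prime_factors n) = 1" by linarith
  then obtain p where p: "prime_factors n = {p}" by (rule card_1_singletonE)
  then have "n = p" using prod_prime_factors[of n] n mult by simp
  then show "prime n" using p by (auto simp: in_prime_factors_iff)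
qed

theorem theorem1:
  shows "(\<forall>(k::nat) (n::nat). k > 0 \<longrightarrow> n > 0 \<longrightarrow>
            (dirichlet_inverse (divisor_sigma k) n + jordan_totient k n + 2 = 0 \<longleftrightarrow> prime n)) \<and>
         (\<forall>n::nat. n > 0 \<longrightarrow>
            (dirichlet_inverse (divisor_sigma 1) n + int (totient n) + 2 = 0 \<longleftrightarrow> prime n))"
proof (intro conjI allI impI)
  show "dirichlet_inverse (divisor_sigma k) n + jordan_totient k n + 2 = 0 \<longleftrightarrow> prime n"
    if "k > 0" "n > 0" for k n
    unfolding dirichlet_inverse_divisor_sigma
    using that by (intro sigma_inverse_jordan_zero_iff_prime)
  then show "dirichlet_inverse (divisor_sigma 1) n + int (totient n) + 2 = 0 \<longleftrightarrow> prime n"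
    if "n > 0" for n
    using that jordan_totient_1_eq_totient[OF that] zero_less_one by metis
qed

end
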